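(* Let $G=(V,E)$ be a finite simple graph with $V\neq\emptyset$, $E\neq\emptyset$, and a linear ordering of $E$, and let $e_{\max}$ be the maximal edge of $G$. Let $c_0(G)=0$ and, for $i=1,2,3,\dots$, $$c_i(G)=\sum_{\substack{V=V_1\sqcup\cdots\sqcup V_{i+1}\\ e_{\max}\notin G[V_j],\ j=1,\dots,i+1}}\ \prod_{j=1}^{i+1}h_1(G[V_j]),$$ where the sum is over all (unordered) decompositions of $V$ into $i+1$ non-empty disjoint subsets $V_1,\dots,V_{i+1}$ such that $e_{\max}$ is not an edge of any $G[V_j]$. Then for all $i\geq 1$, $$h_i(G)=c_{i-1}(G)+c_i(G).$$
   Context: For a finite simple graph $G=(V,E)$ with a linear ordering of $E$, a broken cycle of $G$ is a set of edges obtained by removing the maximal edge from (the edge set of) a cycle of $G$. With $n=|V|$, $h_i(G)$ denotes the number of spanning subgraphs of $G$ with $n-i$ edges containing no broken cycle, i.e. the number of $F\subseteq E$ with $|F|=n-i$ such that no broken cycle of $G$ is a subset of $F$ (so $h_i(G)=0$ for $i>n$). For non-empty $V'\subseteq V$, $G[V']$ is the subgraph of $G$ induced by $V'$, with its edges ordered by the restriction of the ordering of $E$. An empty sum is $0$. *)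

theory Defs
  imports Main "HOL-Library.Disjoint_Sets"
begin

text \<open>Edges are two-element sets of vertices; \<open>(e, f) \<in> ord G\<close> means \<open>e \<le> f\<close>.\<close>

record 'a ordered_graph =
  verts :: "'a set"
  edges :: "'a set set"
  ord :: "('a set \<times> 'a set) set"

definition finite_simple_ordered_graph :: "'a ordered_graph \<Rightarrow> bool" where
  "finite_simple_ordered_graph G \<longleftrightarrow>
     finite (verts G) \<and>
     (\<forall>e \<in> edges G. e \<subseteq> verts G \<and> card e = 2) \<and>
     linear_order_on (edges G) (ord G)"

definition induced :: "'a ordered_graph \<Rightarrow> 'a set \<Rightarrow> 'a ordered_graph" where
  "induced G W =
     \<lparr> verts = W,
       edges = {e \<in> edges G. e \<subseteq> W},
       ord = Restr (ord G) {e \<in> edges G. e \<subseteq> W} \<rparr>"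

text \<open>Only meaningful for nonempty finite \<open>C \<subseteq> edges G\<close>, where the maximum exists and is unique.\<close>

definition max_edge :: "'a ordered_graph \<Rightarrow> 'a set set \<Rightarrow> 'a set" where
  "max_edge G C = (THE m. m \<in> C \<and> (\<forall>e \<in> C. (e, m) \<in> ord G))"

definition closed_edges :: "'a list \<Rightarrow> 'a set set" where
  "closed_edges vs = {{vs ! k, vs ! (Suc k mod length vs)} | k. k < length vs}"

text \<open>A cycle is identified with its edge set.\<close>

definition cycles :: "'a ordered_graph \<Rightarrow> 'a set set set" where
  "cycles G =
     {closed_edges vs | vs. 3 \<le> length vs \<and> distinct vs \<and> set vs \<subseteq> verts G \<and>
                            closed_edges vs \<subseteq> edges G}"

definition broken_cycles :: "'a ordered_graph \<Rightarrow> 'a set set set" where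
  "broken_cycles G = {C - {max_edge G C} | C. C \<in> cycles G}"

text \<open>The condition \<open>card F + i = card (verts G)\<close> avoids truncated subtraction: for
  \<open>i > card (verts G)\<close> there is no such \<open>F\<close>, and the count is \<open>0\<close>.\<close>

definition h :: "nat \<Rightarrow> 'a ordered_graph \<Rightarrow> nat" where
  "h i G = card {F. F \<subseteq> edges G \<and> card F + i = card (verts G) \<and>
                    (\<forall>B \<in> broken_cycles G. \<not> B \<subseteq> F)}"

text \<open>Unordered decompositions are set partitions \<open>P\<close>, whose blocks are nonempty.\<close>

definition c :: "nat \<Rightarrow> 'a ordered_graph \<Rightarrow> nat" where
  "c i G =
     (if i = 0 then 0
      else \<Sum>P \<in> {P. partition_on (verts G) P \<and> card P = i + 1 \<and>
                      (\<forall>W \<in> P. max_edge G (edges G) \<notin> edges (induced G W))}.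
             \<Prod>W \<in> P. h 1 (induced G W))"

end

theory Submission
  imports Defs
begin

text \<open>
  Call \<open>F\<close> \<^emph>\<open>nbc\<close> if it contains no broken cycle. No broken cycle contains the maximal
  edge \<open>e\<close> of \<open>G\<close>, so \<open>F\<close> is nbc iff \<open>insert e F\<close> is. Hence \<open>h\<^sub>i = a\<^sub>i + a\<^sub>i\<^sub>+\<^sub>1\<close>, where
  \<open>a\<^sub>i\<close> counts the nbc sets with \<open>n - i\<close> edges that avoid \<open>e\<close>. An nbc set is a forest, so those
  counted by \<open>a\<^sub>i\<close> have \<open>i\<close> components, and \<open>e\<close> joins two different ones, since otherwise it would
  close a broken cycle. Conversely, a broken cycle is connected, so nbc spanning trees chosen in
  the blocks of a partition have an nbc union. Grouping by the partition into components gives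
  \<open>a\<^sub>i = c\<^sub>i\<^sub>-\<^sub>1\<close>.
\<close>

section \<open>Components and forests\<close>

definition adj :: "'a set set \<Rightarrow> ('a \<times> 'a) set" where
  "adj F = {(x, y). {x, y} \<in> F}"

definition component :: "'a set set \<Rightarrow> 'a \<Rightarrow> 'a set" where
  "component F x = (adj F)\<^sup>* `` {x}"

text \<open>Taking the image over \<open>V\<close> makes every vertex that lies on no edge of
  \<open>F\<close> a component of its own.\<close>

definition components :: "'a set \<Rightarrow> 'a set set \<Rightarrow> 'a set set" where
  "components V F = component F ` V"

text \<open>Acyclicity is encoded as every edge being a bridge, the form in which edges can be added
  one at a time.\<close>

definition forest :: "'a set set \<Rightarrow> bool" where
  "forest F \<longleftrightarrow> (\<forall>u v. {u, v} \<in> F \<longrightarrow> (u, v) \<notin> (adj (F - {{u, v}}))\<^sup>*)"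

lemma sym_adj: "sym (adj F)"
  by (auto simp: adj_def sym_def insert_commute)

lemma adj_mono: "F \<subseteq> F' \<Longrightarrow> adj F \<subseteq> adj F'"
  by (auto simp: adj_def)

lemma adj_rtrancl_sym: "(x, y) \<in> (adj F)\<^sup>* \<Longrightarrow> (y, x) \<in> (adj F)\<^sup>*"
  using sym_rtrancl[OF sym_adj] by (rule symD)

lemma forest_mono:
  assumes "forest F" "F' \<subseteq> F"
  shows "forest F'"
  unfolding forest_def
proof (intro allI impI)
  fix u v assume uv: "{u, v} \<in> F'"
  have "(adj (F' - {{u, v}}))\<^sup>* \<subseteq> (adj (F - {{u, v}}))\<^sup>*"
    using assms(2) by (intro rtrancl_mono adj_mono) auto
  then show "(u, v) \<notin> (adj (F' - {{u, v}}))\<^sup>*"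
    using assms uv by (auto simp: forest_def)
qed

lemma mem_component_self: "x \<in> component F x"
  by (simp add: component_def)

lemma mem_component_iff: "y \<in> component F x \<longleftrightarrow> (x, y) \<in> (adj F)\<^sup>*"
  by (simp add: component_def)

lemma component_eq:
  assumes "y \<in> component F x"
  shows "component F y = component F x"
proof -
  have xy: "(x, y) \<in> (adj F)\<^sup>*" "(y, x) \<in> (adj F)\<^sup>*"
    using assms adj_rtrancl_sym[of x y F] by (simp_all add: mem_component_iff)
  show ?thesis
    unfolding component_def using rtrancl_trans[OF xy(1)] rtrancl_trans[OF xy(2)] by blast
qed

lemma adj_rtrancl_iff: "(x, y) \<in> (adj F)\<^sup>* \<longleftrightarrow> component F x = component F y"
  by (metis component_eq mem_component_iff mem_component_self)

lemma component_subset: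
  assumes "x \<in> W" "\<And>a b. a \<in> W \<Longrightarrow> {a, b} \<in> F \<Longrightarrow> b \<in> W"
  shows "component F x \<subseteq> W"
proof
  fix y assume "y \<in> component F x"
  then have "(x, y) \<in> (adj F)\<^sup>*" by (simp add: component_def)
  then show "y \<in> W"
  proof (induction rule: rtrancl_induct)
    case (step y z)
    then show ?case using assms(2)[of y z] by (simp add: adj_def)
  qed (rule assms(1))
qed

lemma partition_on_components:
  assumes "\<forall>e\<in>F. e \<subseteq> V"
  shows "partition_on V (components V F)"
proof (rule partition_onI)
  show "\<Union> (components V F) = V"
  proof
    have "component F x \<subseteq> V" if "x \<in> V" for x
      using that assms by (intro component_subset) auto
    then show "\<Union> (components V F) \<subseteq> V" by (auto simp: components_def)
    show "V \<subseteq> \<Union> (components V F)" by (auto simp: components_def intro: mem_component_self)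
  qed
  show "disjnt p q" if "p \<in> components V F" "q \<in> components V F" "p \<noteq> q" for p q
  proof -
    obtain x y where xy: "p = component F x" "q = component F y"
      using \<open>p \<in> components V F\<close> \<open>q \<in> components V F\<close> by (auto simp: components_def)
    have "p = q" if "z \<in> p" "z \<in> q" for z
      using component_eq[of z F x] component_eq[of z F y] that xy by simp
    then show ?thesis using \<open>p \<noteq> q\<close> by (auto simp: disjnt_def)
  qed
  show "{} \<notin> components V F"
  proof
    assume "{} \<in> components V F"
    then obtain x where "{} = component F x" by (auto simp: components_def)
    then show False using mem_component_self[of x F] by blast
  qed
qed

text \<open>A walk using the new edge passes between the classes of \<open>u\<close> and
  \<open>v\<close>, so these two merge. They may coincide, and then nothing changes.\<close>

lemma component_insert:
  "component (insert {u, v} F) x =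
     (if x \<in> component F u \<union> component F v then component F u \<union> component F v
      else component F x)"
proof -
  have "adj (insert {u, v} F) = insert (u, v) (insert (v, u) (adj F))"
    by (auto simp: adj_def doubleton_eq_iff)
  \<comment> \<open>\<open>rtrancl_insert\<close> is applied once for each orientation of the edge.
    With reachability rewritten as equality of components, only equational reasoning is
    left.\<close>
  then have "(x, y) \<in> (adj (insert {u, v} F))\<^sup>* \<longleftrightarrow>
      component F x = component F y \<or>
      component F x \<in> {component F u, component F v} \<and>
      component F y \<in> {component F u, component F v}" for y
    by (simp add: rtrancl_insert adj_rtrancl_iff) metis
  then have mem_iff: "y \<in> component (insert {u, v} F) x \<longleftrightarrow>
      component F x = component F y \<or>
      component F x \<in> {component F u, component F v} \<and>
      component F y \<in> {component F u, component F v}" for y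
    by (simp only: mem_component_iff)
  have iff: "y \<in> component F a \<longleftrightarrow> component F a = component F y" for a y
    by (simp only: mem_component_iff adj_rtrancl_iff)
  show ?thesis
  proof (rule set_eqI)
    fix y
    show "y \<in> component (insert {u, v} F) x \<longleftrightarrow> y \<in> (if x \<in> component F u \<union> component F v
        then component F u \<union> component F v else component F x)"
      unfolding mem_iff if_distrib[of "(\<in>) y"] Un_iff iff by (simp only: insert_iff empty_iff) metis
  qed
qed

text \<open>The two components joined by the edge are distinct: they leave the family, their union
  enters it, and no other component changes.\<close>

lemma card_components_insert:
  assumes "finite V" "u \<in> V" "v \<in> V" "(u, v) \<notin> (adj F)\<^sup>*"
  shows "card (components V (insert {u, v} F)) + 1 = card (components V F)"
proof -
  let ?A = "component F u" and ?B = "component F v"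
  have ne: "?A \<noteq> ?B"
    using assms(4) by (simp add: adj_rtrancl_iff)
  have merged: "component (insert {u, v} F) x = ?A \<union> ?B" if "x \<in> ?A \<union> ?B" for x
    unfolding component_insert using that by (rule if_P)
  have kept: "component (insert {u, v} F) x = component F x" if "x \<notin> ?A \<union> ?B" for x
    unfolding component_insert using that by (rule if_not_P)
  have eq: "components V (insert {u, v} F) = insert (?A \<union> ?B) (components V F - {?A, ?B})"
  proof
    show "components V (insert {u, v} F) \<subseteq> insert (?A \<union> ?B) (components V F - {?A, ?B})"
    proof
      fix X assume "X \<in> components V (insert {u, v} F)"
      then obtain x where x: "x \<in> V" "X = component (insert {u, v} F) x"
        unfolding components_def by (rule imageE)
      show "X \<in> insert (?A \<union> ?B) (components V F - {?A, ?B})"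
      proof (cases "x \<in> ?A \<union> ?B")
        case True
        show ?thesis unfolding x(2) merged[OF True] by (rule insertI1)
      next
        case False
        then have "component F x \<notin> {?A, ?B}" using mem_component_self[of x F] by blast
        then show ?thesis unfolding x(2) kept[OF False] components_def using x(1) by blast
      qed
    qed
    have "?A \<union> ?B \<in> components V (insert {u, v} F)"
      unfolding components_def using merged[of u] mem_component_self[of u F] assms(2)
      by (intro image_eqI[of _ _ u]) blast+
    moreover have "component F x \<in> components V (insert {u, v} F)"
      if "x \<in> V" "component F x \<notin> {?A, ?B}" for x
    proof -
      have "x \<notin> ?A \<union> ?B" using component_eq[of x F u] component_eq[of x F v] that(2) by blast
      then show ?thesis
        unfolding components_def using kept[of x] that(1) by (metis imageI)
    qed
    ultimately show "insert (?A \<union> ?B) (components V F - {?A, ?B})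
        \<subseteq> components V (insert {u, v} F)"
      unfolding components_def by blast
  qed
  \<comment> \<open>The union is really new: a component containing \<open>u\<close> can only be
    \<open>?A\<close>, which has been removed.\<close>
  have notin: "?A \<union> ?B \<notin> components V F - {?A, ?B}"
  proof
    assume "?A \<union> ?B \<in> components V F - {?A, ?B}"
    then obtain x where x: "?A \<union> ?B = component F x" "component F x \<noteq> ?A"
      unfolding components_def by blast
    then have "u \<in> component F x" using mem_component_self[of u F] by blast
    then show False using component_eq[of u F x] x by blast
  qed
  have fin: "finite (components V F)" using assms(1) by (simp add: components_def)
  have sub: "{?A, ?B} \<subseteq> components V F" using assms(2,3) by (simp add: components_def)
  then have "card (components V F - {?A, ?B}) + 2 = card (components V F)"
    using card_mono[OF fin sub] ne by (simp add: card_Diff_subset)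
  moreover have "card (components V (insert {u, v} F)) = Suc (card (components V F - {?A, ?B}))"
    unfolding eq using notin fin by (intro card_insert_disjoint) simp_all
  ultimately show ?thesis by simp
qed

text \<open>Induction over the edges: each is a bridge, so adding it lowers the number of components
  by one.\<close>

lemma forest_card:
  assumes "finite V" "\<forall>e\<in>F. e \<subseteq> V \<and> card e = 2" "forest F"
  shows "card (components V F) + card F = card V"
proof -
  have "finite F" using assms by (intro finite_subset[of F "Pow V"]) auto
  then show ?thesis using assms(2,3)
  proof (induction F rule: finite_induct)
    case empty
    have "component {} x = {x}" for x :: 'a
      by (auto simp: component_def adj_def)
    then have "components V {} = (\<lambda>x. {x}) ` V"
      by (simp add: components_def)
    then show ?case by (simp add: card_image)
  next
    case (insert e F)
    have "forest F" using insert.prems(2) by (rule forest_mono) auto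
    then have IH: "card (components V F) + card F = card V"
      using insert by blast
    obtain u v where e: "e = {u, v}" using insert.prems by (auto simp: card_2_iff)
    have "insert e F - {e} = F" using insert by auto
    then have "(u, v) \<notin> (adj F)\<^sup>*"
      using insert.prems(2) e unfolding forest_def by (metis insertI1)
    then have "card (components V (insert e F)) + 1 = card (components V F)"
      unfolding e using card_components_insert assms(1) insert.prems(1) e by auto
    then show ?case using IH insert by simp
  qed
qed

text \<open>Sending each block of \<open>Q\<close> to the block of \<open>P\<close> around it is
  surjective, since \<open>Q\<close> covers the nonempty blocks of \<open>P\<close>. By the
  cardinality bound it is then injective, so every block of \<open>P\<close> is filled by a single
  block of \<open>Q\<close>.\<close>

lemma refine_eq_partition:
  assumes P: "partition_on V P" and Q: "partition_on V Q" and "finite Q"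
    and card: "card Q \<le> card P" and refine: "\<And>q. q \<in> Q \<Longrightarrow> \<exists>p\<in>P. q \<subseteq> p"
  shows "Q = P"
proof -
  obtain g where g: "\<And>q. q \<in> Q \<Longrightarrow> g q \<in> P \<and> q \<subseteq> g q" using refine by metis
  have uniq: "p = p'" if "p \<in> P" "p' \<in> P" "x \<in> p" "x \<in> p'" for p p' x
    using partition_onD2[OF P] that by (auto simp: disjoint_def)
  have cover: "\<exists>q\<in>Q. x \<in> q \<and> g q = p" if "p \<in> P" "x \<in> p" for p x
  proof -
    have "x \<in> \<Union>Q" using that partition_onD1[OF P] partition_onD1[OF Q] by auto
    then show ?thesis using g uniq that by blast
  qed
  have "g ` Q = P"
  proof
    show "g ` Q \<subseteq> P" using g by blast
    show "P \<subseteq> g ` Q"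
    proof
      fix p assume p: "p \<in> P"
      then obtain x where "x \<in> p" using partition_onD3[OF P] by (metis ex_in_conv)
      then show "p \<in> g ` Q" using cover[OF p] by blast
    qed
  qed
  then have inj: "inj_on g Q"
    using card card_image_le[OF \<open>finite Q\<close>, of g] \<open>finite Q\<close>
    by (intro eq_card_imp_inj_on) auto
  have gq: "g q = q" if q: "q \<in> Q" for q
  proof
    show "q \<subseteq> g q" using g[OF q] by blast
    show "g q \<subseteq> q"
    proof
      fix x assume "x \<in> g q"
      then obtain q' where "q' \<in> Q" "x \<in> q'" "g q' = g q" using cover g[OF q] by blast
      then show "x \<in> q" using inj_onD[OF inj, of q' q] q by simp
    qed
  qed
  have "g ` Q = Q" using gq by simp
  with \<open>g ` Q = P\<close> show ?thesis by simp
qed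

section \<open>Cycles\<close>

text \<open>A step to a vertex already on the path is handled by cutting the path off at that
  vertex, which keeps it free of repetitions.\<close>

lemma adj_rtrancl_path:
  assumes "(u, v) \<in> (adj F)\<^sup>*"
  shows "\<exists>vs. vs \<noteq> [] \<and> hd vs = u \<and> last vs = v \<and> distinct vs \<and>
           (\<forall>k. Suc k < length vs \<longrightarrow> {vs ! k, vs ! Suc k} \<in> F)"
  using assms
proof (induction rule: rtrancl_induct)
  case base
  then show ?case by (intro exI[of _ "[u]"]) auto
next
  case (step y z)
  then obtain vs where vs: "vs \<noteq> []" "hd vs = u" "last vs = y" "distinct vs"
    "\<forall>k. Suc k < length vs \<longrightarrow> {vs ! k, vs ! Suc k} \<in> F" by blast
  show ?case
  proof (cases "z \<in> set vs")
    case True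
    then obtain k where k: "k < length vs" "vs ! k = z" by (auto simp: in_set_conv_nth)
    have "last (take (Suc k) vs) = z" using k by (simp add: take_Suc_conv_app_nth)
    then show ?thesis using vs by (intro exI[of _ "take (Suc k) vs"]) auto
  next
    case False
    have "{(vs @ [z]) ! k, (vs @ [z]) ! Suc k} \<in> F" if "Suc k < length (vs @ [z])" for k
    proof (cases "Suc k < length vs")
      case True
      then show ?thesis using vs by (auto simp: nth_append)
    next
      case False
      then have "Suc k = length vs" using that by simp
      then have "vs ! k = y" using vs by (metis diff_Suc_1 last_conv_nth)
      then show ?thesis using \<open>Suc k = length vs\<close> step.hyps(2)
        by (auto simp: nth_append adj_def)
    qed
    then show ?thesis using vs False by (intro exI[of _ "vs @ [z]"]) auto
  qed
qed

text \<open>A simple path from \<open>u\<close> to \<open>v\<close> in \<open>F\<close> is closed up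
  by the edge itself.\<close>

lemma cycle_through_edge:
  assumes edges: "\<forall>e\<in>edges G. e \<subseteq> verts G \<and> card e = 2"
    and "F \<subseteq> edges G" "{u, v} \<in> edges G" "{u, v} \<notin> F" "(u, v) \<in> (adj F)\<^sup>*"
  shows "\<exists>C\<in>cycles G. {u, v} \<in> C \<and> C \<subseteq> insert {u, v} F"
proof -
  obtain vs where vs: "vs \<noteq> []" "hd vs = u" "last vs = v" "distinct vs"
    "\<And>k. Suc k < length vs \<Longrightarrow> {vs ! k, vs ! Suc k} \<in> F"
    using adj_rtrancl_path assms by meson
  have "u \<noteq> v" using edges assms(3) by fastforce
  have ends: "vs ! 0 = u" "vs ! (length vs - 1) = v"
    using vs by (auto simp: hd_conv_nth last_conv_nth)
  \<comment> \<open>One vertex would force \<open>u = v\<close>; two would put \<open>{u, v}\<close>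
    into \<open>F\<close>.\<close>
  have len: "3 \<le> length vs"
  proof (rule ccontr)
    assume "\<not> 3 \<le> length vs"
    moreover have "length vs \<noteq> 0" using vs(1) by simp
    ultimately have "length vs = 1 \<or> length vs = 2" by linarith
    then show False using ends \<open>u \<noteq> v\<close> vs(5)[of 0] assms(4) by auto
  qed
  \<comment> \<open>At the last index the successor wraps to 0, which gives the closing edge from
    \<open>v\<close> back to \<open>u\<close>.\<close>
  have step: "{vs ! k, vs ! (Suc k mod length vs)} \<in> insert {u, v} F" if "k < length vs" for k
  proof (cases "Suc k < length vs")
    case True
    then show ?thesis using vs(5) by simp
  next
    case False
    then have "Suc k = length vs" using that by simp
    moreover from this have "k = length vs - 1" by simp
    ultimately show ?thesis using ends by (simp add: insert_commute)
  qed
  then have sub: "closed_edges vs \<subseteq> insert {u, v} F" by (auto simp: closed_edges_def)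
  have "{vs ! (length vs - 1), vs ! (Suc (length vs - 1) mod length vs)} = {u, v}"
    using ends vs(1) by (simp add: insert_commute)
  then have mem: "{u, v} \<in> closed_edges vs"
    using len unfolding closed_edges_def
    by (intro CollectI exI[of _ "length vs - 1"]) auto
  have "set vs \<subseteq> verts G"
  proof
    fix x assume "x \<in> set vs"
    then obtain k where "k < length vs" "x = vs ! k" by (auto simp: in_set_conv_nth)
    then have "x \<in> {vs ! k, vs ! (Suc k mod length vs)}"
      "{vs ! k, vs ! (Suc k mod length vs)} \<in> edges G" using step[of k] assms(2,3) by auto
    then show "x \<in> verts G" using edges by blast
  qed
  then have "closed_edges vs \<in> cycles G"
    using sub assms(2,3) len vs(4) unfolding cycles_def by blast
  with mem sub show ?thesis by blast
qed

text \<open>If equal edges stood at different positions, each position would be the cyclic successor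
  of the other, so the length would divide 2.\<close>

lemma closed_edges_nth_inj:
  assumes "distinct vs" "3 \<le> length vs" "j < length vs" "k < length vs"
    and "{vs ! j, vs ! (Suc j mod length vs)} = {vs ! k, vs ! (Suc k mod length vs)}"
  shows "j = k"
proof (rule ccontr)
  let ?n = "length vs"
  assume "j \<noteq> k"
  have lt: "Suc j mod ?n < ?n" "Suc k mod ?n < ?n"
    using assms(2) by (auto intro!: mod_less_divisor)
  have "j = Suc k mod ?n" "Suc j mod ?n = k"
    using assms \<open>j \<noteq> k\<close> lt by (auto simp: doubleton_eq_iff nth_eq_iff_index_eq)
  then show False using assms(2-4) by (auto simp: mod_Suc split: if_splits)
qed

text \<open>The only step at which \<open>f\<close> may change is the one leaving \<open>k\<close>.
  Positions up to \<open>k\<close> are reached upwards from 0, those beyond \<open>k\<close>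
  downwards from \<open>n - 1\<close>, whose successor is 0.\<close>

lemma cyclic_constant:
  fixes f :: "nat \<Rightarrow> 'b"
  assumes "\<And>j. j < n \<Longrightarrow> j \<noteq> k \<Longrightarrow> f (Suc j mod n) = f j" and "k < n" "j < n"
  shows "f j = f 0"
proof (cases "j \<le> k")
  case True
  then show ?thesis
  proof (induction j)
    case (Suc j)
    then show ?case using assms(1)[of j] \<open>k < n\<close> by simp
  qed simp
next
  case False
  have "j \<le> n - 1" using assms(3) by simp
  then show ?thesis using False
  proof (induction j rule: inc_induct)
    case base
    then show ?case using assms(1)[of "n - 1"] \<open>k < n\<close> by simp
  next
    case (step j)
    then show ?case using assms(1)[of j] by simp
  qed
qed

text \<open>Deleting one edge leaves a cycle connected.\<close>

lemma broken_cycle_in_block: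
  assumes "distinct vs" "3 \<le> length vs"
    and block: "\<And>x y. {x, y} \<in> closed_edges vs - {m} \<Longrightarrow> x \<in> W \<longleftrightarrow> y \<in> W"
    and "vs ! 0 \<in> W"
  shows "set vs \<subseteq> W"
proof -
  let ?n = "length vs" and ?e = "\<lambda>k. {vs ! k, vs ! (Suc k mod length vs)}"
  \<comment> \<open>\<open>k\<close> is the one position whose edge may be \<open>m\<close>. If
    \<open>m\<close> is not on the cycle, any position serves and 0 is taken.\<close>
  have "\<exists>k<?n. \<forall>j<?n. j \<noteq> k \<longrightarrow> ?e j \<noteq> m"
  proof (cases "\<exists>k<?n. ?e k = m")
    case True
    then obtain k where "k < ?n" "?e k = m" by blast
    then show ?thesis using closed_edges_nth_inj[OF assms(1,2)] by metis
  next
    case False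
    then show ?thesis using assms(2) by (intro exI[of _ 0]) auto
  qed
  then obtain k where k: "k < ?n" "\<And>j. j < ?n \<Longrightarrow> j \<noteq> k \<Longrightarrow> ?e j \<noteq> m" by blast
  have "(vs ! (Suc j mod ?n) \<in> W) = (vs ! j \<in> W)" if "j < ?n" "j \<noteq> k" for j
  proof -
    have "?e j \<in> closed_edges vs - {m}" using k that by (auto simp: closed_edges_def)
    then show ?thesis using block by blast
  qed
  then have "(vs ! j \<in> W) = (vs ! 0 \<in> W)" if "j < ?n" for j
    using cyclic_constant[of ?n k "\<lambda>j. vs ! j \<in> W" j] k(1) that by blast
  then show ?thesis using assms(4) by (auto simp: in_set_conv_nth)
qed

section \<open>Broken cycles\<close>

definition nbc :: "'a ordered_graph \<Rightarrow> 'a set set \<Rightarrow> bool" where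
  "nbc G F \<longleftrightarrow> F \<subseteq> edges G \<and> (\<forall>B\<in>broken_cycles G. \<not> B \<subseteq> F)"

lemma h_eq_card_nbc: "h i G = card {F. nbc G F \<and> card F + i = card (verts G)}"
  unfolding h_def nbc_def by (rule arg_cong[of _ _ card]) auto

lemma induced_simps [simp]:
  "verts (induced G W) = W" "edges (induced G W) = {e \<in> edges G. e \<subseteq> W}"
  by (simp_all add: induced_def)

lemma max_edge_induced:
  assumes "C \<subseteq> edges (induced G W)"
  shows "max_edge (induced G W) C = max_edge G C"
proof -
  have "(m \<in> C \<and> (\<forall>e\<in>C. (e, m) \<in> ord (induced G W))) \<longleftrightarrow> (m \<in> C \<and> (\<forall>e\<in>C. (e, m) \<in> ord G))" for m
    using assms by (auto simp: induced_def)
  then show ?thesis by (simp add: max_edge_def)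
qed

text \<open>The order of the induced subgraph is a restriction, so a cycle inside \<open>W\<close>
  loses the same maximal edge in both graphs.\<close>

lemma broken_cycles_induced:
  assumes "W \<subseteq> verts G"
  shows "broken_cycles (induced G W) \<subseteq> broken_cycles G"
proof
  fix B assume "B \<in> broken_cycles (induced G W)"
  then obtain C where C: "C \<in> cycles (induced G W)" "B = C - {max_edge (induced G W) C}"
    by (auto simp: broken_cycles_def)
  then have "C \<subseteq> edges (induced G W)" "C \<in> cycles G"
    using assms unfolding cycles_def by auto
  then show "B \<in> broken_cycles G"
    using C(2) max_edge_induced[of C G W] unfolding broken_cycles_def by auto
qed

lemma nbc_induced:
  assumes "nbc G F" "W \<subseteq> verts G"
  shows "nbc (induced G W) (F \<inter> Pow W)"
  using assms(1) subsetD[OF broken_cycles_induced[OF assms(2)]] unfolding nbc_def by simp blast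

text \<open>An edge whose ends stay connected without it lies on a cycle contained in
  \<open>F\<close>, and any cycle contains its own broken cycle.\<close>

lemma nbc_forest:
  assumes "\<forall>e\<in>edges G. e \<subseteq> verts G \<and> card e = 2" "nbc G F"
  shows "forest F"
  unfolding forest_def
proof (intro allI impI notI)
  fix u v assume uv: "{u, v} \<in> F" "(u, v) \<in> (adj (F - {{u, v}}))\<^sup>*"
  have "\<exists>C\<in>cycles G. {u, v} \<in> C \<and> C \<subseteq> insert {u, v} (F - {{u, v}})"
    using assms(2) uv unfolding nbc_def by (intro cycle_through_edge[OF assms(1)]) blast+
  then obtain C where C: "C \<in> cycles G" "C \<subseteq> insert {u, v} (F - {{u, v}})" by blast
  then have "C - {max_edge G C} \<subseteq> F" using uv(1) by blast
  moreover have "C - {max_edge G C} \<in> broken_cycles G"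
    using C(1) unfolding broken_cycles_def by blast
  ultimately show False using assms(2) unfolding nbc_def by blast
qed

lemma partition_blocks_eq:
  assumes "partition_on V P" "W \<in> P" "W' \<in> P" "x \<in> W" "x \<in> W'"
  shows "W = W'"
  using assms partition_onD2[OF assms(1)] by (auto simp: disjoint_def)

text \<open>Every edge of \<open>F\<close> stays within a block and a broken cycle is connected, so
  a broken cycle in \<open>F\<close> would lie in one block \<open>W\<close> and already be a broken
  cycle of \<open>induced G W\<close>.\<close>

lemma nbc_glue:
  assumes P: "partition_on (verts G) P" and F: "F \<subseteq> edges G" "\<And>e. e \<in> F \<Longrightarrow> \<exists>W\<in>P. e \<subseteq> W"
    and block: "\<And>W. W \<in> P \<Longrightarrow> nbc (induced G W) (F \<inter> Pow W)"
  shows "nbc G F"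
  unfolding nbc_def
proof (intro conjI F(1) ballI notI)
  fix B assume "B \<in> broken_cycles G" and BF: "B \<subseteq> F"
  then obtain vs where vs: "B = closed_edges vs - {max_edge G (closed_edges vs)}"
    "3 \<le> length vs" "distinct vs" "set vs \<subseteq> verts G" "closed_edges vs \<subseteq> edges G"
    by (auto simp: broken_cycles_def cycles_def)
  have "vs ! 0 \<in> verts G" using vs(2,4) by (metis nth_mem not_numeral_le_zero gr0I subsetD)
  then obtain W where W: "W \<in> P" "vs ! 0 \<in> W"
    using partition_onD1[OF P] by auto
  have "x \<in> W \<longleftrightarrow> y \<in> W" if xy: "{x, y} \<in> B" for x y
  proof -
    obtain W' where "W' \<in> P" "{x, y} \<subseteq> W'" using F(2) BF xy by blast
    then show ?thesis using partition_blocks_eq[OF P \<open>W \<in> P\<close> \<open>W' \<in> P\<close>] by auto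
  qed
  then have set_vs: "set vs \<subseteq> W"
    using broken_cycle_in_block[OF vs(3,2)] W(2) vs(1) by blast
  have "vs ! (Suc k mod length vs) \<in> W" if "k < length vs" for k
  proof -
    have "Suc k mod length vs < length vs" using that by (intro mod_less_divisor) auto
    then show ?thesis using set_vs by (meson nth_mem subsetD)
  qed
  \<comment> \<open>The removed edge need not be in \<open>F\<close>, but its ends are vertices of
    the cycle, so it lies in \<open>W\<close> as well.\<close>
  then have CW: "closed_edges vs \<subseteq> Pow W"
    using set_vs by (auto simp: closed_edges_def)
  then have sub: "closed_edges vs \<subseteq> edges (induced G W)" using vs(5) by auto
  then have "closed_edges vs \<in> cycles (induced G W)"
    using vs set_vs unfolding cycles_def by auto
  then have "B \<in> broken_cycles (induced G W)"
    unfolding broken_cycles_def using vs(1) max_edge_induced[OF sub] by auto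
  moreover have "B \<subseteq> F \<inter> Pow W" using BF CW vs(1) by auto
  ultimately show False using block[OF W(1)] by (auto simp: nbc_def)
qed

section \<open>The maximal edge\<close>

lemma max_edge_eqI:
  assumes "linear_order_on (edges G) (ord G)" "m \<in> C" "\<And>e. e \<in> C \<Longrightarrow> (e, m) \<in> ord G"
  shows "max_edge G C = m"
proof -
  have "antisym (ord G)"
    using assms(1) by (auto simp: linear_order_on_def partial_order_on_def)
  then show ?thesis
    unfolding max_edge_def using assms(2,3) by (intro the_equality) (auto dest: antisymD)
qed

lemma linear_order_on_finite_max:
  assumes "linear_order_on A r" "finite C" "C \<noteq> {}" "C \<subseteq> A"
  shows "\<exists>m\<in>C. \<forall>x\<in>C. (x, m) \<in> r"
  using assms(2-4)
proof (induction C rule: finite_ne_induct)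
  case (singleton x)
  then show ?case using assms(1)
    by (auto simp: linear_order_on_def partial_order_on_def preorder_on_def refl_on_def)
next
  case (insert x C)
  then obtain m where m: "m \<in> C" "\<forall>y\<in>C. (y, m) \<in> r" by auto
  have r: "refl_on A r" "trans r" "total_on A r"
    using assms(1) by (auto simp: linear_order_on_def partial_order_on_def preorder_on_def)
  have "(x, m) \<in> r \<or> (m, x) \<in> r" "(x, x) \<in> r"
    using r insert.prems m(1) by (metis insert_subset refl_onD subsetD total_on_def)+
  then show ?case using m r(2) by (auto dest: transD)
qed

context
  fixes G :: "'a ordered_graph" and emax :: "'a set"
  assumes G: "finite_simple_ordered_graph G" "edges G \<noteq> {}"
  defines "emax \<equiv> max_edge G (edges G)"
begin

lemma finite_verts: "finite (verts G)"
  and edges_doubletons: "\<forall>e\<in>edges G. e \<subseteq> verts G \<and> card e = 2"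
  and linear_ord: "linear_order_on (edges G) (ord G)"
  using G by (auto simp: finite_simple_ordered_graph_def)

lemma finite_edges: "finite (edges G)"
  using finite_verts edges_doubletons by (intro finite_subset[of "edges G" "Pow (verts G)"]) auto

lemma emax_greatest: "emax \<in> edges G" "e \<in> edges G \<Longrightarrow> (e, emax) \<in> ord G"
proof -
  obtain m where "m \<in> edges G" "\<forall>e\<in>edges G. (e, m) \<in> ord G"
    using linear_order_on_finite_max[OF linear_ord finite_edges G(2)] by auto
  moreover from this have "emax = m"
    unfolding emax_def by (intro max_edge_eqI[OF linear_ord]) auto
  ultimately show "emax \<in> edges G" "e \<in> edges G \<Longrightarrow> (e, emax) \<in> ord G" by auto
qed

lemma max_edge_eq_emax:
  assumes "C \<in> cycles G" "emax \<in> C"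
  shows "max_edge G C = emax"
  using assms emax_greatest(2)
  by (intro max_edge_eqI[OF linear_ord]) (auto simp: cycles_def)

text \<open>A cycle through \<open>emax\<close> has it as its maximal edge, and so loses exactly
  this edge.\<close>

lemma emax_notin_broken_cycle: "B \<in> broken_cycles G \<Longrightarrow> emax \<notin> B"
  using max_edge_eq_emax by (fastforce simp: broken_cycles_def)

lemma nbc_insert_emax: "nbc G (insert emax F) \<longleftrightarrow> nbc G F"
  using emax_notin_broken_cycle emax_greatest(1) unfolding nbc_def by blast

lemma nbc_remove_emax: "nbc G (F - {emax}) \<longleftrightarrow> nbc G F"
  by (metis insert_Diff_single nbc_insert_emax)

text \<open>A path in \<open>F\<close> between the ends of \<open>emax\<close> would close to a
  cycle with maximal edge \<open>emax\<close>; without \<open>emax\<close>, this is a broken cycle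
  inside \<open>F\<close>.\<close>

lemma emax_not_in_component:
  assumes "nbc G F" "emax \<notin> F" "W \<in> components (verts G) F"
  shows "\<not> emax \<subseteq> W"
proof
  assume "emax \<subseteq> W"
  obtain u v where uv: "emax = {u, v}"
    using emax_greatest(1) edges_doubletons by (meson card_2_iff)
  obtain x where "W = component F x" using assms(3) by (auto simp: components_def)
  with uv \<open>emax \<subseteq> W\<close> have "component F u = W" "v \<in> W"
    using component_eq[of u F x] by auto
  then have "(u, v) \<in> (adj F)\<^sup>*" by (auto simp: component_def)
  then have "\<exists>C\<in>cycles G. {u, v} \<in> C \<and> C \<subseteq> insert {u, v} F"
    using assms emax_greatest(1) uv
    by (intro cycle_through_edge[OF edges_doubletons]) (auto simp: nbc_def)
  then obtain C where C: "C \<in> cycles G" "emax \<in> C" "C \<subseteq> insert emax F" using uv by auto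
  then have "C - {emax} \<in> broken_cycles G"
    using max_edge_eq_emax[of C] unfolding broken_cycles_def by blast
  moreover have "C - {emax} \<subseteq> F" using C(3) by blast
  ultimately show False using assms(1) unfolding nbc_def by blast
qed

section \<open>Splitting the count at the maximal edge\<close>

definition nbc_avoiding :: "nat \<Rightarrow> 'a set set set" where
  "nbc_avoiding i = {F. nbc G F \<and> emax \<notin> F \<and> card F + i = card (verts G)}"

text \<open>The index is the number of blocks, one more than the index of \<open>c\<close>.\<close>

definition emax_partitions :: "nat \<Rightarrow> 'a set set set" where
  "emax_partitions i = {P. partition_on (verts G) P \<and> card P = i \<and>
     (\<forall>W\<in>P. emax \<notin> edges (induced G W))}"

lemma finite_nbc: "finite {F. nbc G F \<and> Q F}"
  by (rule finite_subset[of _ "Pow (edges G)"]) (use finite_edges in \<open>auto simp: nbc_def\<close>)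

text \<open>Sets containing \<open>emax\<close> correspond to sets avoiding it by deletion of
  \<open>emax\<close>; one edge fewer means an index one higher.\<close>

lemma h_eq_nbc_avoiding: "h i G = card (nbc_avoiding i) + card (nbc_avoiding (Suc i))"
proof -
  have finF: "finite F" if "nbc G F" for F
    using that finite_subset[OF _ finite_edges] by (simp add: nbc_def)
  have "bij_betw (insert emax) (nbc_avoiding (Suc i))
          {F. nbc G F \<and> emax \<in> F \<and> card F + i = card (verts G)}"
  proof (rule bij_betw_byWitness[where f' = "\<lambda>F. F - {emax}"])
    show "insert emax ` nbc_avoiding (Suc i) \<subseteq>
        {F. nbc G F \<and> emax \<in> F \<and> card F + i = card (verts G)}"
      by (auto simp: nbc_avoiding_def nbc_insert_emax finF)
    have "card (F - {emax}) + Suc i = card (verts G)"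
      if "nbc G F" "emax \<in> F" "card F + i = card (verts G)" for F
      using that finF[of F] card_Suc_Diff1[of F emax] by simp
    then show "(\<lambda>F. F - {emax}) ` {F. nbc G F \<and> emax \<in> F \<and> card F + i = card (verts G)}
        \<subseteq> nbc_avoiding (Suc i)"
      by (auto simp: nbc_avoiding_def nbc_remove_emax)
  qed (auto simp: nbc_avoiding_def)
  then have "card (nbc_avoiding (Suc i)) =
      card {F. nbc G F \<and> emax \<in> F \<and> card F + i = card (verts G)}"
    by (rule bij_betw_same_card)
  moreover have "{F. nbc G F \<and> card F + i = card (verts G)} =
      nbc_avoiding i \<union> {F. nbc G F \<and> emax \<in> F \<and> card F + i = card (verts G)}"
    by (auto simp: nbc_avoiding_def)
  moreover have "finite (nbc_avoiding i)"
    "finite {F. nbc G F \<and> emax \<in> F \<and> card F + i = card (verts G)}"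
    unfolding nbc_avoiding_def by (rule finite_nbc)+
  moreover have "nbc_avoiding i \<inter>
      {F. nbc G F \<and> emax \<in> F \<and> card F + i = card (verts G)} = {}"
    by (auto simp: nbc_avoiding_def)
  ultimately show ?thesis
    by (simp add: h_eq_card_nbc card_Un_disjoint)
qed

text \<open>For a set in \<open>nbc_avoiding i\<close> this identifies \<open>i\<close> as the
  number of components.\<close>

lemma card_components_nbc:
  assumes "nbc G F"
  shows "card (components (verts G) F) + card F = card (verts G)"
  using assms edges_doubletons nbc_forest[OF edges_doubletons assms]
  by (intro forest_card finite_verts) (auto simp: nbc_def)

lemma partition_on_components_nbc: "nbc G F \<Longrightarrow> partition_on (verts G) (components (verts G) F)"
  using edges_doubletons by (intro partition_on_components) (auto simp: nbc_def)

lemma components_in_emax_partitions: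
  assumes "F \<in> nbc_avoiding i"
  shows "components (verts G) F \<in> emax_partitions i"
  using assms card_components_nbc[of F] partition_on_components_nbc[of F] emax_not_in_component[of F]
  unfolding nbc_avoiding_def emax_partitions_def by fastforce

lemma finite_emax_partitions: "finite (emax_partitions i)"
proof (rule finite_subset)
  show "emax_partitions i \<subseteq> Pow (Pow (verts G))"
    by (auto simp: emax_partitions_def partition_on_def)
  show "finite (Pow (Pow (verts G)))" using finite_verts by simp
qed

section \<open>Edges and trees in the blocks of a partition\<close>

lemma disjoint_Pow_edges:
  assumes P: "partition_on (verts G) P" "W \<in> P" "W' \<in> P" "W \<noteq> W'"
  shows "edges G \<inter> Pow W \<inter> Pow W' = {}"
proof (rule equals0I)
  fix e assume e: "e \<in> edges G \<inter> Pow W \<inter> Pow W'"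
  \<comment> \<open>\<open>Pow W\<close> and \<open>Pow W'\<close> always share the empty set, so
    disjointness of the blocks helps only once \<open>e\<close> has an element.\<close>
  then have "e \<noteq> {}" using edges_doubletons by fastforce
  then obtain x where "x \<in> e" by blast
  then show False using e partition_blocks_eq[OF P(1-3)] P(4) by blast
qed

lemma card_partition_edges:
  assumes P: "partition_on (verts G) P" and F: "F \<subseteq> edges G" "\<And>e. e \<in> F \<Longrightarrow> \<exists>W\<in>P. e \<subseteq> W"
  shows "card F = (\<Sum>W\<in>P. card (F \<inter> Pow W))"
proof -
  have "finite P" "finite F"
    using finite_elements[OF finite_verts P] finite_subset[OF F(1) finite_edges] .
  have "F = (\<Union>W\<in>P. F \<inter> Pow W)" using F(2) by auto
  then have "card F = card (\<Union>W\<in>P. F \<inter> Pow W)" by simp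
  also have "\<dots> = (\<Sum>W\<in>P. card (F \<inter> Pow W))"
  proof (rule card_UN_disjoint)
    show "\<forall>W\<in>P. \<forall>W'\<in>P. W \<noteq> W' \<longrightarrow> F \<inter> Pow W \<inter> (F \<inter> Pow W') = {}"
      using disjoint_Pow_edges[OF P] F(1) by blast
  qed (use \<open>finite P\<close> \<open>finite F\<close> in auto)
  finally show ?thesis .
qed

lemma card_partition_verts:
  assumes "partition_on (verts G) P"
  shows "(\<Sum>W\<in>P. card W) = card (verts G)"
proof (rule product_partition[OF assms, symmetric])
  show "finite W" if "W \<in> P" for W
    using that finite_verts partition_onD1[OF assms] by (auto intro: rev_finite_subset)
qed

text \<open>For a block \<open>W\<close> these are the sets counted by
  \<open>h 1 (induced G W)\<close>. Being forests with \<open>card W - 1\<close> edges on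
  \<open>W\<close>, they are spanning trees of \<open>W\<close>.\<close>

definition block_trees :: "'a set \<Rightarrow> 'a set set set" where
  "block_trees W = {F. nbc (induced G W) F \<and> card F + 1 = card W}"

lemma nbc_edge_in_component:
  assumes "nbc G F" "e \<in> F"
  shows "\<exists>W\<in>components (verts G) F. e \<subseteq> W"
proof -
  have "e \<in> edges G" using assms by (auto simp: nbc_def)
  then have "e \<subseteq> verts G" "card e = 2" using edges_doubletons by auto
  then obtain u v where e: "e = {u, v}" "u \<in> verts G" by (auto simp: card_2_iff)
  have "(u, v) \<in> adj F" using assms e by (simp add: adj_def)
  then have "e \<subseteq> component F u" using e by (auto simp: component_def)
  then show ?thesis using e(2) unfolding components_def by blast
qed

text \<open>
  Each block carries at most \<open>card W - 1\<close> edges of the forest \<open>F\<close>, and summing over the blocks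
  shows that the bound is attained everywhere.
\<close>

lemma nbc_restrict_block_trees:
  assumes F: "nbc G F" and W: "W \<in> components (verts G) F"
  shows "F \<inter> Pow W \<in> block_trees W"
proof -
  let ?P = "components (verts G) F"
  have P: "partition_on (verts G) ?P" using F by (rule partition_on_components_nbc)
  have finP: "finite ?P" using finite_elements[OF finite_verts P] .
  have sub: "W' \<subseteq> verts G" if "W' \<in> ?P" for W' using partition_onD1[OF P] that by auto
  have le: "card (F \<inter> Pow W') + 1 \<le> card W'" if W': "W' \<in> ?P" for W'
  proof -
    have fin: "finite W'" using sub[OF W'] finite_verts finite_subset by blast
    have "forest (F \<inter> Pow W')"
      using nbc_forest[OF edges_doubletons F] by (rule forest_mono) auto
    then have "card (components W' (F \<inter> Pow W')) + card (F \<inter> Pow W') = card W'"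
      using fin F edges_doubletons by (intro forest_card) (auto simp: nbc_def)
    \<comment> \<open>A nonempty block has at least one component, which accounts for the 1 in the
      bound.\<close>
    moreover have "components W' (F \<inter> Pow W') \<noteq> {}"
      using partition_onD3[OF P] W' by (auto simp: components_def)
    then have "card (components W' (F \<inter> Pow W')) \<noteq> 0"
      using fin by (simp add: components_def)
    ultimately show ?thesis by linarith
  qed
  have "F \<subseteq> edges G" using F by (simp add: nbc_def)
  then have "card F = (\<Sum>W'\<in>?P. card (F \<inter> Pow W'))"
    using card_partition_edges[OF P _ nbc_edge_in_component[OF F]] by blast
  then have "(\<Sum>W'\<in>?P. card (F \<inter> Pow W') + 1) = (\<Sum>W'\<in>?P. card W')"
    using card_partition_verts[OF P] card_components_nbc[OF F] by (simp add: sum_Suc)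
  then have "card (F \<inter> Pow W) + 1 = card W"
    by (rule sum_mono_inv[OF _ _ W finP]) (rule le)
  then show ?thesis
    using nbc_induced[OF F sub[OF W]] by (simp add: block_trees_def)
qed

text \<open>No edge lies in two different blocks, so cutting the union back to \<open>W\<close>
  returns exactly the tree chosen there.\<close>

lemma glue_restrict:
  assumes P: "partition_on (verts G) P" and f: "\<And>W. W \<in> P \<Longrightarrow> f W \<in> block_trees W" and "W \<in> P"
  shows "\<Union> (f ` P) \<inter> Pow W = f W"
proof -
  have sub: "f W' \<subseteq> edges G \<inter> Pow W'" if "W' \<in> P" for W'
    using f[OF that] by (auto simp: block_trees_def nbc_def)
  then show ?thesis using disjoint_Pow_edges[OF P _ \<open>W \<in> P\<close>] \<open>W \<in> P\<close> by blast
qed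

text \<open>The union has \<open>card W - 1\<close> edges in each block \<open>W\<close>, hence as
  many components as \<open>P\<close> has blocks. No edge crosses between blocks, so the components
  refine \<open>P\<close>, and equal numbers force equality.\<close>

lemma glue_block_trees:
  assumes P: "P \<in> emax_partitions i" and f: "\<And>W. W \<in> P \<Longrightarrow> f W \<in> block_trees W"
  shows "\<Union> (f ` P) \<in> nbc_avoiding i" "components (verts G) (\<Union> (f ` P)) = P"
proof -
  let ?F = "\<Union> (f ` P)"
  have part: "partition_on (verts G) P" and cardP: "card P = i"
    using P by (auto simp: emax_partitions_def)
  have sub: "f W \<subseteq> edges (induced G W)" if "W \<in> P" for W
    using f[OF that] by (auto simp: block_trees_def nbc_def)
  have FE: "?F \<subseteq> edges G" and FP: "\<And>e. e \<in> ?F \<Longrightarrow> \<exists>W\<in>P. e \<subseteq> W" using sub by auto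
  have restr: "?F \<inter> Pow W = f W" if "W \<in> P" for W using glue_restrict[OF part f that] .
  have nbc: "nbc G ?F"
    using f restr by (intro nbc_glue[OF part FE FP]) (auto simp: block_trees_def)
  have "card ?F + card P = (\<Sum>W\<in>P. card (?F \<inter> Pow W) + 1)"
    using card_partition_edges[OF part FE FP] by (simp add: sum_Suc)
  also have "\<dots> = (\<Sum>W\<in>P. card W)"
    using f restr by (intro sum.cong) (auto simp: block_trees_def)
  finally have cardF: "card ?F + i = card (verts G)"
    using card_partition_verts[OF part] cardP by simp
  \<comment> \<open>\<open>emax\<close> lies in no block of \<open>P\<close>, so no chosen tree can
    use it.\<close>
  have "emax \<notin> ?F" using sub P unfolding emax_partitions_def by blast
  then show "?F \<in> nbc_avoiding i" using nbc cardF by (simp add: nbc_avoiding_def)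
  show "components (verts G) ?F = P"
  proof (rule refine_eq_partition[OF part partition_on_components_nbc[OF nbc]])
    show "finite (components (verts G) ?F)" using finite_verts by (simp add: components_def)
    show "card (components (verts G) ?F) \<le> card P"
      using card_components_nbc[OF nbc] cardF cardP by simp
    fix q assume "q \<in> components (verts G) ?F"
    then obtain x where x: "x \<in> verts G" "q = component ?F x" by (auto simp: components_def)
    then obtain W where W: "W \<in> P" "x \<in> W" using partition_onD1[OF part] by auto
    have "component ?F x \<subseteq> W"
    proof (rule component_subset[OF W(2)])
      fix a b assume ab: "a \<in> W" "{a, b} \<in> ?F"
      then obtain W' where "W' \<in> P" "{a, b} \<subseteq> W'" using FP by blast
      then show "b \<in> W" using partition_blocks_eq[OF part W(1), of W' a] ab by auto
    qed
    then show "\<exists>p\<in>P. q \<subseteq> p" using W x by auto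
  qed
qed

text \<open>Restriction to the blocks and union are mutually inverse, so a set with component
  partition \<open>P\<close> amounts to an independent choice of a tree in each block.\<close>

lemma card_nbc_avoiding_components:
  assumes P: "P \<in> emax_partitions i"
  shows "card {F \<in> nbc_avoiding i. components (verts G) F = P} = (\<Prod>W\<in>P. h 1 (induced G W))"
proof -
  have part: "partition_on (verts G) P" using P by (simp add: emax_partitions_def)
  have finP: "finite P" using finite_elements[OF finite_verts part] .
  have "bij_betw (\<lambda>F. \<lambda>W\<in>P. F \<inter> Pow W) {F \<in> nbc_avoiding i. components (verts G) F = P}
          (PiE P block_trees)"
  proof (rule bij_betw_byWitness[where f' = "\<lambda>f. \<Union> (f ` P)"], goal_cases)
    case 1
    have "\<Union> ((\<lambda>W\<in>P. F \<inter> Pow W) ` P) = F" if "nbc G F" "components (verts G) F = P" for F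
      using nbc_edge_in_component[OF that(1)] that(2) by auto
    then show ?case by (simp add: nbc_avoiding_def)
  next
    case 2
    \<comment> \<open>Functions in \<open>PiE\<close> are \<open>undefined\<close> off
      \<open>P\<close>, as is the restricted function, so agreement on \<open>P\<close>
      suffices.\<close>
    show ?case
      using glue_restrict[OF part] by (auto intro!: extensionalityI[of _ P] simp: PiE_iff)
  next
    case 3
    show ?case using nbc_restrict_block_trees by (auto simp: nbc_avoiding_def)
  next
    case 4
    show ?case using glue_block_trees[OF P] by (auto simp: PiE_iff)
  qed
  then have "card {F \<in> nbc_avoiding i. components (verts G) F = P} = card (PiE P block_trees)"
    by (rule bij_betw_same_card)
  also have "\<dots> = (\<Prod>W\<in>P. card (block_trees W))" using finP by (rule card_PiE)
  finally show ?thesis by (simp add: h_eq_card_nbc block_trees_def)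
qed

text \<open>The family is split into the fibres of the map to component partitions, whose values lie
  in \<open>emax_partitions i\<close>.\<close>

lemma card_nbc_avoiding:
  "card (nbc_avoiding i) = (\<Sum>P\<in>emax_partitions i. \<Prod>W\<in>P. h 1 (induced G W))"
proof -
  have "card (nbc_avoiding i) =
      (\<Sum>P\<in>emax_partitions i. \<Sum>F\<in>{F \<in> nbc_avoiding i. components (verts G) F = P}. 1)"
    using finite_nbc finite_emax_partitions components_in_emax_partitions
    unfolding card_eq_sum by (intro sum.group[symmetric]) (auto simp: nbc_avoiding_def)
  then show ?thesis using card_nbc_avoiding_components by simp
qed

text \<open>The value 0 that \<open>c\<close> has at \<open>i = 0\<close> is the right one: the
  block of a one-block partition is \<open>verts G\<close>, which contains
  \<open>emax\<close>.\<close>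

lemma c_eq_nbc_avoiding: "c i G = card (nbc_avoiding (Suc i))"
proof (cases "i = 0")
  case True
  have "emax_partitions 1 = {}"
  proof (rule equals0I)
    fix P assume "P \<in> emax_partitions 1"
    then have P: "partition_on (verts G) P" "card P = 1" "\<forall>W\<in>P. emax \<notin> edges (induced G W)"
      by (auto simp: emax_partitions_def)
    then obtain W where "P = {W}" by (meson card_1_singletonE)
    then show False using P partition_onD1[OF P(1)] emax_greatest(1) edges_doubletons by auto
  qed
  then show ?thesis using True by (simp add: card_nbc_avoiding c_def)
next
  case False
  then show ?thesis by (simp add: card_nbc_avoiding c_def emax_partitions_def emax_def)
qed

end

theorem lemma2p6:
  fixes G :: "'a ordered_graph" and i :: nat
  assumes "finite_simple_ordered_graph G"
    and "verts G \<noteq> {}"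
    and "edges G \<noteq> {}"
    and "i \<ge> 1"
  shows "h i G = c (i - 1) G + c i G"
  \<comment> \<open>Since \<open>i \<ge> 1\<close>, the index \<open>Suc (i - 1)\<close> arising
    from \<open>c (i - 1) G\<close> is \<open>i\<close>.\<close>
  using assms by (simp add: h_eq_nbc_avoiding c_eq_nbc_avoiding)

end
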